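(* Let $0<q<1$ and $\alpha\ge0$. Then, for all $x\in[0,1]$, $$S_\infty^{q,\alpha}(e_0;x)=1,\qquad S_\infty^{q,\alpha}(e_1;x)=x,\qquad S_\infty^{q,\alpha}(e_2;x)=x-\frac{qx(1-x)}{1+\alpha}.$$
   Context: Write $e_m(t)=t^m$. The $q$-Pochhammer symbols are $(a;q)_0=1$, $(a;q)_m=\prod_{j=0}^{m-1}(1-aq^j)$, $(a;q)_\infty=\prod_{j=0}^\infty(1-aq^j)$. Empty products equal $1$ and $0^0=1$. Put $\gamma=\alpha/(1-q)$. For $k\in\mathbb{N}_0$ and $x\in[0,1]$ let $$p_{\infty k}^{q,\alpha}(x)=\frac{\left(\frac{\gamma}{x+\gamma};q\right)_k\left(\frac{x+\gamma}{1+\gamma};q\right)_\infty\left(\frac{x+\gamma}{1+\gamma}\right)^k}{(q;q)_k\left(\frac{\gamma}{1+\gamma};q\right)_\infty},$$ where the product $\left(\frac{\gamma}{x+\gamma};q\right)_k\left(\frac{x+\gamma}{1+\gamma}\right)^k$ is read as $(1+\gamma)^{-k}\prod_{i=0}^{k-1}(x+\gamma-\gamma q^i)$ (relevant only when $x=\gamma=0$). The limit $q$-Stancu operator on $f\in C[0,1]$ is $$S_\infty^{q,\alpha}(f;x)=\sum_{k=0}^\infty f(1-q^k)\,p_{\infty k}^{q,\alpha}(x)\ \text{ for } x\in[0,1),\qquad S_\infty^{q,\alpha}(f;1)=f(1).$$ *)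

theory Defs
  imports "HOL-Analysis.Analysis"
begin

definition qpoch :: "real \<Rightarrow> real \<Rightarrow> nat \<Rightarrow> real" where
  "qpoch a q m = (\<Prod>j<m. 1 - a * q ^ j)"

definition qpoch_inf :: "real \<Rightarrow> real \<Rightarrow> real" where
  "qpoch_inf a q = (\<Prod>j. 1 - a * q ^ j)"

lemma convergent_prod_qpoch:
  fixes a q :: real
  assumes "\<bar>q\<bar> < 1"
  shows "convergent_prod (\<lambda>j. 1 - a * q ^ j)"
proof -
  have "summable (\<lambda>j. \<bar>a\<bar> * \<bar>q\<bar> ^ j)"
    using assms by (intro summable_mult summable_geometric) auto
  then have "summable (\<lambda>j. norm ((1 - a * q ^ j) - 1))"
    by (simp add: abs_mult power_abs)
  then show ?thesis
    by (intro abs_convergent_prod_imp_convergent_prod)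
       (simp add: abs_convergent_prod_conv_summable)
qed

definition stancu_gamma :: "real \<Rightarrow> real \<Rightarrow> real" where
  "stancu_gamma q \<alpha> = \<alpha> / (1 - q)"

text \<open>
  If \<open>x = \<gamma> = 0\<close>, the quotient \<open>\<gamma> / (x + \<gamma>)\<close> below is \<open>0 / 0 = 0\<close>. The lemma
  \<open>qpoch_times_power\<close> shows that the product of the first and third factor of the
  numerator then still has its intended value
  \<open>(1 + \<gamma>)\<^sup>-\<^sup>k (\<Prod>i<k. x + \<gamma> - \<gamma> q\<^sup>i)\<close>.
\<close>
definition limit_stancu_basis :: "real \<Rightarrow> real \<Rightarrow> nat \<Rightarrow> real \<Rightarrow> real" where
  "limit_stancu_basis q \<alpha> k x =
     (let \<gamma> = stancu_gamma q \<alpha> in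
        qpoch (\<gamma> / (x + \<gamma>)) q k * qpoch_inf ((x + \<gamma>) / (1 + \<gamma>)) q * ((x + \<gamma>) / (1 + \<gamma>)) ^ k
        / (qpoch q q k * qpoch_inf (\<gamma> / (1 + \<gamma>)) q))"

lemma qpoch_times_power:
  fixes x \<gamma> q :: real
  assumes "0 \<le> x" "0 \<le> \<gamma>"
  shows "qpoch (\<gamma> / (x + \<gamma>)) q k * ((x + \<gamma>) / (1 + \<gamma>)) ^ k
       = (\<Prod>i<k. x + \<gamma> - \<gamma> * q ^ i) / (1 + \<gamma>) ^ k"
proof (cases "x + \<gamma> = 0")
  case True
  with assms have "x = 0" "\<gamma> = 0" by auto
  then show ?thesis by (cases k) (auto simp: qpoch_def)
next
  case False
  have "(1 - \<gamma> / (x + \<gamma>) * q ^ i) * (x + \<gamma>) = x + \<gamma> - \<gamma> * q ^ i" for i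
    using False by (simp add: field_simps)
  then have "(\<Prod>i<k. x + \<gamma> - \<gamma> * q ^ i)
      = (\<Prod>i<k. (1 - \<gamma> / (x + \<gamma>) * q ^ i) * (x + \<gamma>))"
    by simp
  also have "\<dots> = qpoch (\<gamma> / (x + \<gamma>)) q k * (x + \<gamma>) ^ k"
    by (simp only: qpoch_def prod.distrib prod_constant card_lessThan)
  finally show ?thesis by (simp add: power_divide)
qed

definition limit_stancu :: "real \<Rightarrow> real \<Rightarrow> (real \<Rightarrow> real) \<Rightarrow> real \<Rightarrow> real" where
  "limit_stancu q \<alpha> f x =
     (if x = 1 then f 1 else (\<Sum>k. f (1 - q ^ k) * limit_stancu_basis q \<alpha> k x))"

definition test_monomial :: "nat \<Rightarrow> real \<Rightarrow> real" where
  "test_monomial m t = t ^ m"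

end

theory Submission
  imports Defs
begin

text \<open>
  At \<open>x = 1\<close> the operator is evaluation, so let \<open>x < 1\<close>.
  Put \<open>\<gamma> = \<alpha> / (1 - q)\<close>, \<open>z = (x + \<gamma>) / (1 + \<gamma>)\<close> and \<open>c = \<gamma> / (1 + \<gamma>)\<close>. Up to the factor
  \<open>(z;q)\<^sub>\<infinity> / (c;q)\<^sub>\<infinity>\<close>, which does not depend on \<open>k\<close>, the basis functions at \<open>x\<close> are the terms
  \<open>T\<^sub>k = (\<Prod>i<k. z - c q\<^sup>i) / (q;q)\<^sub>k\<close> of the \<open>q\<close>-binomial series. Since the nodes are \<open>1 - q\<^sup>k\<close>,
  the values of the operator on polynomials are combinations of the moments
  \<open>M\<^sub>j = (\<Sum>k. q\<^sup>j\<^sup>k T\<^sub>k)\<close>.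

  The terms satisfy \<open>(1 - q\<^sup>k\<^sup>+\<^sup>1) T\<^sub>k\<^sub>+\<^sub>1 = (z - c q\<^sup>k) T\<^sub>k\<close>. Multiplying by \<open>q\<^sup>j\<^sup>(\<^sup>k\<^sup>+\<^sup>1\<^sup>)\<close> and summing over
  all \<open>k\<close> gives \<open>M\<^sub>j - M\<^sub>j\<^sub>+\<^sub>1 = q\<^sup>j (z M\<^sub>j - c M\<^sub>j\<^sub>+\<^sub>1)\<close>, that is
  \<open>(1 - z q\<^sup>j) M\<^sub>j = (1 - c q\<^sup>j) M\<^sub>j\<^sub>+\<^sub>1\<close> (lemma \<open>qbinom_moment_Suc\<close>).

  This one recursion does all the work. Iterated infinitely often, with \<open>M\<^sub>n \<longlonglongrightarrow> T\<^sub>0 = 1\<close>, it yields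
  the \<open>q\<close>-binomial theorem \<open>(z;q)\<^sub>\<infinity> M\<^sub>0 = (c;q)\<^sub>\<infinity>\<close> (lemma \<open>q_binomial_theorem\<close>), so the basis
  functions sum to one. Used once and twice, it gives the normalised moments
  \<open>M\<^sub>1 / M\<^sub>0 = (1 - z) / (1 - c) = 1 - x\<close> and \<open>M\<^sub>2 / M\<^sub>1 = (1 - q z) / (1 - q c) = 1 - q x / (1 + \<alpha>)\<close>,
  from which the images of \<open>t = 1 - (1 - t)\<close> and \<open>t\<^sup>2 = 1 - 2 (1 - t) + (1 - t)\<^sup>2\<close> are read off.
\<close>

section \<open>The q-binomial series and its moments\<close>

text \<open>
  In the usual notation with \<open>c = a z\<close> this is \<open>(a;q)\<^sub>k z\<^sup>k / (q;q)\<^sub>k\<close>. Taking \<open>c\<close> instead of \<open>a\<close> as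
  the parameter avoids the quotient \<open>a = c / z\<close>, so that \<open>z = 0\<close> is not exceptional.
\<close>
definition qbinom_term :: "real \<Rightarrow> real \<Rightarrow> real \<Rightarrow> nat \<Rightarrow> real" where
  "qbinom_term q c z k = (\<Prod>i<k. z - c * q ^ i) / qpoch q q k"

definition qbinom_moment :: "real \<Rightarrow> real \<Rightarrow> real \<Rightarrow> nat \<Rightarrow> real" where
  "qbinom_moment q c z j = (\<Sum>k. (q ^ j) ^ k * qbinom_term q c z k)"

lemma one_minus_mult_power_pos:
  fixes a q :: real
  assumes "\<bar>q\<bar> < 1" "\<bar>a\<bar> < 1"
  shows "0 < 1 - a * q ^ j"
proof -
  have "\<bar>a * q ^ j\<bar> \<le> \<bar>a\<bar> * 1"
    unfolding abs_mult power_abs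
    using assms by (intro mult_left_mono power_le_one) auto
  with assms show ?thesis by linarith
qed

lemma qpoch_inf_nonzero:
  assumes "\<bar>q\<bar> < 1" "\<bar>a\<bar> < 1"
  shows "qpoch_inf a q \<noteq> 0"
  unfolding qpoch_inf_def
  using one_minus_mult_power_pos[OF assms]
  by (intro prodinf_nonzero convergent_prod_qpoch assms) (simp add: less_imp_neq[symmetric])

lemma qpoch_tendsto_qpoch_inf:
  assumes "\<bar>q\<bar> < 1"
  shows "(\<lambda>n. qpoch a q n) \<longlonglongrightarrow> qpoch_inf a q"
proof -
  have "(\<lambda>n. qpoch a q (Suc n)) \<longlonglongrightarrow> qpoch_inf a q"
    using convergent_prod_LIMSEQ[OF convergent_prod_qpoch[OF assms, of a]]
    by (simp add: qpoch_def qpoch_inf_def lessThan_Suc_atMost del: prod.lessThan_Suc)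
  then show ?thesis by (simp only: filterlim_sequentially_Suc)
qed

lemma qbinom_term_0 [simp]: "qbinom_term q c z 0 = 1"
  by (simp add: qbinom_term_def qpoch_def)

lemma qbinom_term_Suc:
  assumes "\<bar>q\<bar> < 1"
  shows "(1 - q ^ Suc k) * qbinom_term q c z (Suc k) = (z - c * q ^ k) * qbinom_term q c z k"
  using one_minus_mult_power_pos[OF assms assms, of k]
  by (simp add: qbinom_term_def qpoch_def divide_simps)

text \<open>The quotient of consecutive terms tends to \<open>z\<close>, so the ratio test applies.\<close>
lemma summable_norm_qbinom_term:
  assumes q: "\<bar>q\<bar> < 1" and z: "\<bar>z\<bar> < 1"
  shows "summable (\<lambda>k. norm (qbinom_term q c z k))"
proof -
  let ?r = "\<lambda>k. (z - c * q ^ k) / (1 - q * q ^ k)"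
  obtain s where s: "\<bar>z\<bar> < s" "s < 1" using z dense by blast
  have "(\<lambda>k. \<bar>?r k\<bar>) \<longlonglongrightarrow> \<bar>(z - c * 0) / (1 - q * 0)\<bar>"
    using q by (intro tendsto_intros) auto
  then have "\<forall>\<^sub>F k in sequentially. \<bar>?r k\<bar> < s" using s by (intro order_tendstoD) auto
  then obtain N where N: "\<And>k. N \<le> k \<Longrightarrow> \<bar>?r k\<bar> < s"
    by (auto simp: eventually_sequentially)
  show ?thesis
  proof (rule summable_ratio_test[OF s(2), of N])
    fix k assume "N \<le> k"
    have "qbinom_term q c z (Suc k) = ?r k * qbinom_term q c z k"
      using qbinom_term_Suc[OF q, of k c z] one_minus_mult_power_pos[OF q q, of k]
      by (simp add: field_simps)
    then have "norm (qbinom_term q c z (Suc k)) = \<bar>?r k\<bar> * norm (qbinom_term q c z k)"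
      by (simp only: real_norm_def abs_mult)
    also have "\<dots> \<le> s * norm (qbinom_term q c z k)"
      using N[OF \<open>N \<le> k\<close>] by (intro mult_right_mono) auto
    finally show "norm (norm (qbinom_term q c z (Suc k))) \<le> s * norm (norm (qbinom_term q c z k))"
      by simp
  qed
qed

lemma abs_power_power_mult_le:
  fixes q y :: real
  assumes "\<bar>q\<bar> < 1"
  shows "norm ((q ^ j) ^ k * y) \<le> norm y"
proof -
  have "\<bar>q\<bar> ^ (j * k) \<le> 1" using assms by (intro power_le_one) auto
  then show ?thesis
    by (simp add: abs_mult power_abs power_mult[symmetric] mult_left_le_one_le)
qed

lemma qbinom_moment_sums:
  assumes "\<bar>q\<bar> < 1" "\<bar>z\<bar> < 1"
  shows "(\<lambda>k. (q ^ j) ^ k * qbinom_term q c z k) sums qbinom_moment q c z j"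
  unfolding qbinom_moment_def
  by (intro summable_sums summable_comparison_test'[OF summable_norm_qbinom_term[OF assms]])
     (rule abs_power_power_mult_le[OF assms(1)])

text \<open>
  The series of \<open>(q\<^sup>j)\<^sup>k (1 - q\<^sup>k) T\<^sub>k\<close> is evaluated in two ways: directly as a difference of moments,
  and, since its first term vanishes, after an index shift by the recursion for the terms.
\<close>
lemma qbinom_moment_Suc:
  assumes q: "\<bar>q\<bar> < 1" and z: "\<bar>z\<bar> < 1"
  shows "(1 - z * q ^ j) * qbinom_moment q c z j = (1 - c * q ^ j) * qbinom_moment q c z (Suc j)"
proof -
  let ?T = "qbinom_term q c z" and ?M = "qbinom_moment q c z"
  let ?g = "\<lambda>k. (q ^ j) ^ k * ((1 - q ^ k) * ?T k)"
  note sums = qbinom_moment_sums[OF q z]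
  have "(\<lambda>k. (q ^ j) ^ k * ?T k - (q ^ Suc j) ^ k * ?T k) sums (?M j - ?M (Suc j))"
    by (intro sums_diff sums)
  then have direct: "?g sums (?M j - ?M (Suc j))"
    by (simp add: algebra_simps)
  have shift: "?g (Suc k) = q ^ j * (z * ((q ^ j) ^ k * ?T k) - c * ((q ^ Suc j) ^ k * ?T k))" for k
    unfolding qbinom_term_Suc[OF q] by (simp add: algebra_simps)
  have "(\<lambda>k. ?g (Suc k)) sums (q ^ j * (z * ?M j - c * ?M (Suc j)))"
    unfolding shift by (intro sums_mult sums_diff sums)
  then have "?g sums (q ^ j * (z * ?M j - c * ?M (Suc j)))"
    by (subst (asm) sums_Suc_iff) simp
  with direct have "?M j - ?M (Suc j) = q ^ j * (z * ?M j - c * ?M (Suc j))"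
    by (rule sums_unique2)
  then show ?thesis by (simp add: algebra_simps)
qed

text \<open>
  Only the term with index \<open>0\<close> survives in the limit: the rest of the series has a common factor \<open>q\<^sup>n\<close>
  and is otherwise bounded by the series of absolute values.
\<close>
lemma qbinom_moment_tendsto_1:
  assumes q: "\<bar>q\<bar> < 1" and z: "\<bar>z\<bar> < 1"
  shows "qbinom_moment q c z \<longlonglongrightarrow> 1"
proof -
  let ?T = "qbinom_term q c z"
  define C where "C = (\<Sum>k. norm (?T (Suc k)))"
  have norm_summable: "summable (\<lambda>k. norm (?T (Suc k)))"
    using summable_norm_qbinom_term[OF q z] by (subst summable_Suc_iff)
  have bound: "norm (qbinom_moment q c z n - 1) \<le> C * \<bar>q\<bar> ^ n" for n
  proof -
    let ?h = "\<lambda>k. (q ^ n) ^ k * ?T (Suc k)"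
    have le: "norm (?h k) \<le> norm (?T (Suc k))" for k
      by (rule abs_power_power_mult_le[OF q])
    have h: "summable (\<lambda>k. norm (?h k))"
      by (rule summable_comparison_test'[OF norm_summable]) (use le in simp)
    have "(\<lambda>k. q ^ n * ?h k) sums (q ^ n * suminf ?h)"
      by (intro sums_mult summable_sums summable_norm_cancel[OF h])
    moreover have "(\<lambda>k. q ^ n * ?h k) sums (qbinom_moment q c z n - 1)"
      using qbinom_moment_sums[OF q z, of n c]
        sums_Suc_iff[of "\<lambda>k. (q ^ n) ^ k * ?T k" "qbinom_moment q c z n - 1"]
      by (simp add: mult.assoc)
    ultimately have "qbinom_moment q c z n - 1 = q ^ n * suminf ?h"
      using sums_unique2 by blast
    moreover have "norm (suminf ?h) \<le> C"
      unfolding C_def using summable_norm[OF h] suminf_le[OF le h norm_summable] by simp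
    ultimately show ?thesis
      by (simp add: abs_mult power_abs mult.commute[of C] mult_left_mono)
  qed
  have "(\<lambda>n. C * \<bar>q\<bar> ^ n) \<longlonglongrightarrow> C * 0"
    using q by (intro tendsto_intros LIMSEQ_power_zero) auto
  then have "(\<lambda>n. C * \<bar>q\<bar> ^ n) \<longlonglongrightarrow> 0" by simp
  then have "(\<lambda>n. qbinom_moment q c z n - 1) \<longlonglongrightarrow> 0"
    by (rule Lim_null_comparison[OF always_eventually[OF allI[OF bound]]])
  then show ?thesis by (simp only: LIM_zero_iff)
qed

theorem q_binomial_theorem:
  assumes q: "\<bar>q\<bar> < 1" and z: "\<bar>z\<bar> < 1"
  shows "qpoch_inf z q * qbinom_moment q c z 0 = qpoch_inf c q"
proof -
  let ?M = "qbinom_moment q c z"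
  have finite_form: "qpoch z q n * ?M 0 = qpoch c q n * ?M n" for n
  proof (induction n)
    case 0
    show ?case by (simp add: qpoch_def)
  next
    case (Suc n)
    have "qpoch z q (Suc n) * ?M 0 = (1 - z * q ^ n) * (qpoch z q n * ?M 0)"
      by (simp add: qpoch_def)
    also have "\<dots> = qpoch c q n * ((1 - z * q ^ n) * ?M n)"
      unfolding Suc.IH by simp
    also have "\<dots> = qpoch c q (Suc n) * ?M (Suc n)"
      unfolding qbinom_moment_Suc[OF q z] by (simp add: qpoch_def)
    finally show ?case .
  qed
  have "(\<lambda>n. qpoch z q n * ?M 0) \<longlonglongrightarrow> qpoch_inf z q * ?M 0"
    by (intro tendsto_intros qpoch_tendsto_qpoch_inf q)
  moreover have "(\<lambda>n. qpoch z q n * ?M 0) \<longlonglongrightarrow> qpoch_inf c q * 1"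
    unfolding finite_form
    by (intro tendsto_mult qpoch_tendsto_qpoch_inf qbinom_moment_tendsto_1 q z)
  ultimately show ?thesis using LIMSEQ_unique by fastforce
qed

section \<open>Moments of the limit q-Stancu basis\<close>

lemma limit_stancu_basis_eq_qbinom_term:
  fixes q \<alpha> x :: real
  defines "\<gamma> \<equiv> stancu_gamma q \<alpha>"
  assumes "0 \<le> x" "0 \<le> \<gamma>"
  shows "limit_stancu_basis q \<alpha> k x
    = qpoch_inf ((x + \<gamma>) / (1 + \<gamma>)) q / qpoch_inf (\<gamma> / (1 + \<gamma>)) q
      * qbinom_term q (\<gamma> / (1 + \<gamma>)) ((x + \<gamma>) / (1 + \<gamma>)) k"
proof -
  have "(\<Prod>i<k. (x + \<gamma>) / (1 + \<gamma>) - \<gamma> / (1 + \<gamma>) * q ^ i)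
      = (\<Prod>i<k. (x + \<gamma> - \<gamma> * q ^ i) / (1 + \<gamma>))"
    by (simp add: diff_divide_distrib)
  also have "\<dots> = (\<Prod>i<k. x + \<gamma> - \<gamma> * q ^ i) / (1 + \<gamma>) ^ k"
    by (simp add: prod_dividef)
  also have "\<dots> = qpoch (\<gamma> / (x + \<gamma>)) q k * ((x + \<gamma>) / (1 + \<gamma>)) ^ k"
    using qpoch_times_power[OF assms(2,3)] by simp
  finally show ?thesis
    by (simp add: limit_stancu_basis_def Let_def \<gamma>_def[symmetric] qbinom_term_def mult_ac)
qed

text \<open>
  The three sums are \<open>M\<^sub>j / M\<^sub>0\<close> for \<open>j = 0, 1, 2\<close>, because the constant factor of the basis is \<open>1 / M\<^sub>0\<close>
  by the \<open>q\<close>-binomial theorem.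
\<close>
lemma limit_stancu_basis_moments:
  fixes q \<alpha> x :: real
  assumes q: "0 < q" "q < 1" and \<alpha>: "0 \<le> \<alpha>" and x: "0 \<le> x" "x < 1"
  shows "(\<lambda>k. limit_stancu_basis q \<alpha> k x) sums 1"
    and "(\<lambda>k. q ^ k * limit_stancu_basis q \<alpha> k x) sums (1 - x)"
    and "(\<lambda>k. (q ^ 2) ^ k * limit_stancu_basis q \<alpha> k x) sums ((1 - x) * (1 - q * x / (1 + \<alpha>)))"
proof -
  define \<gamma> where "\<gamma> = stancu_gamma q \<alpha>"
  define z where "z = (x + \<gamma>) / (1 + \<gamma>)"
  define c where "c = \<gamma> / (1 + \<gamma>)"
  define w where "w = qpoch_inf z q / qpoch_inf c q"
  let ?M = "qbinom_moment q c z"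
  have \<gamma>: "0 \<le> \<gamma>" using q \<alpha> by (simp add: \<gamma>_def stancu_gamma_def)
  have \<alpha>_eq: "\<alpha> = (1 - q) * \<gamma>" using q by (simp add: \<gamma>_def stancu_gamma_def)
  have abs_q: "\<bar>q\<bar> < 1" and abs_z: "\<bar>z\<bar> < 1" and abs_c: "\<bar>c\<bar> < 1"
    using q x \<gamma> by (simp_all add: z_def c_def)
  have moment_sums: "(\<lambda>k. (q ^ j) ^ k * limit_stancu_basis q \<alpha> k x) sums (w * ?M j)" for j
    using sums_mult[OF qbinom_moment_sums[OF abs_q abs_z, of j c], of w]
      limit_stancu_basis_eq_qbinom_term[OF x(1), of q \<alpha>] \<gamma>
    by (simp add: \<gamma>_def[symmetric] z_def[symmetric] c_def[symmetric] w_def[symmetric] mult_ac)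
  have M0: "w * ?M 0 = 1"
    using q_binomial_theorem[OF abs_q abs_z, of c] qpoch_inf_nonzero[OF abs_q abs_c]
    by (simp add: w_def)
  have factor_1: "1 - z = (1 - x) * (1 - c)"
    using \<gamma> by (simp add: z_def c_def field_simps)
  \<comment> \<open>The parameter \<open>\<alpha>\<close> enters the result here: \<open>(1 + \<gamma>) (1 - q c) = 1 + (1 - q) \<gamma> = 1 + \<alpha>\<close>.\<close>
  have factor_2: "1 - z * q = (1 - q * x / (1 + \<alpha>)) * (1 - c * q)"
  proof -
    have c_q: "1 - c * q = (1 + \<alpha>) / (1 + \<gamma>)"
      using \<gamma> by (simp add: c_def \<alpha>_eq field_simps)
    have "1 - q * x / (1 + \<alpha>) = (1 + \<alpha> - q * x) / (1 + \<alpha>)"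
      using \<alpha> by (simp add: diff_divide_distrib)
    then have "(1 - q * x / (1 + \<alpha>)) * (1 - c * q) = (1 + \<alpha> - q * x) / (1 + \<gamma>)"
      using \<alpha> unfolding c_q by simp
    also have "\<dots> = 1 - z * q"
      using \<gamma> by (simp add: z_def \<alpha>_eq field_simps)
    finally show ?thesis by simp
  qed
  have c_nonzero: "1 - c \<noteq> 0" "1 - c * q \<noteq> 0"
    using one_minus_mult_power_pos[OF abs_q abs_c, of 0]
      one_minus_mult_power_pos[OF abs_q abs_c, of 1] by auto
  have M1: "?M 1 = (1 - x) * ?M 0"
    using qbinom_moment_Suc[OF abs_q abs_z, of 0 c] c_nonzero(1) by (simp add: factor_1)
  have M2: "?M 2 = (1 - q * x / (1 + \<alpha>)) * ?M 1"
    using qbinom_moment_Suc[OF abs_q abs_z, of 1 c] c_nonzero(2)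
    by (simp add: factor_2 numeral_2_eq_2)
  have "w * ?M 1 = 1 - x"
    using M0 M1 by (simp add: mult.left_commute)
  moreover from this have "w * ?M 2 = (1 - x) * (1 - q * x / (1 + \<alpha>))"
    unfolding M2 by (metis mult.commute mult.left_commute)
  ultimately show "(\<lambda>k. limit_stancu_basis q \<alpha> k x) sums 1"
    and "(\<lambda>k. q ^ k * limit_stancu_basis q \<alpha> k x) sums (1 - x)"
    and "(\<lambda>k. (q ^ 2) ^ k * limit_stancu_basis q \<alpha> k x) sums ((1 - x) * (1 - q * x / (1 + \<alpha>)))"
    using moment_sums[of 0] moment_sums[of 1] moment_sums[of 2] M0 by simp_all
qed

section \<open>The limit q-Stancu operator on quadratic polynomials\<close>

theorem theorem3p7:
  fixes q \<alpha> :: real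
  assumes "0 < q" "q < 1" "0 \<le> \<alpha>"
  shows "\<forall>x\<in>{0..1}.
           limit_stancu q \<alpha> (test_monomial 0) x = 1 \<and>
           limit_stancu q \<alpha> (test_monomial 1) x = x \<and>
           limit_stancu q \<alpha> (test_monomial 2) x = x - q * x * (1 - x) / (1 + \<alpha>)"
proof
  fix x :: real
  assume "x \<in> {0..1}"
  show "limit_stancu q \<alpha> (test_monomial 0) x = 1 \<and>
        limit_stancu q \<alpha> (test_monomial 1) x = x \<and>
        limit_stancu q \<alpha> (test_monomial 2) x = x - q * x * (1 - x) / (1 + \<alpha>)"
  proof (cases "x = 1")
    case True
    then show ?thesis by (simp add: limit_stancu_def test_monomial_def)
  next
    case False
    with \<open>x \<in> {0..1}\<close> have x: "0 \<le> x" "x < 1" by auto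
    let ?p = "\<lambda>k. limit_stancu_basis q \<alpha> k x"
    note moments = limit_stancu_basis_moments[OF assms x]
    have eq: "limit_stancu q \<alpha> f x = s" if "(\<lambda>k. f (1 - q ^ k) * ?p k) sums s" for f s
      using that False by (simp add: limit_stancu_def sums_iff)
    have "limit_stancu q \<alpha> (test_monomial 0) x = 1"
      using moments(1) by (intro eq) (simp add: test_monomial_def)
    moreover have "limit_stancu q \<alpha> (test_monomial 1) x = x"
      using sums_diff[OF moments(1,2)]
      by (intro eq) (simp add: test_monomial_def algebra_simps)
    moreover have "limit_stancu q \<alpha> (test_monomial 2) x = x - q * x * (1 - x) / (1 + \<alpha>)"
    proof (rule eq)
      let ?s = "(1 - 2 * (1 - x)) + (1 - x) * (1 - q * x / (1 + \<alpha>))"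
      have "(\<lambda>k. (?p k - 2 * (q ^ k * ?p k)) + (q ^ 2) ^ k * ?p k) sums ?s"
        by (intro sums_add sums_diff sums_mult moments)
      moreover have "(?p k - 2 * (q ^ k * ?p k)) + (q ^ 2) ^ k * ?p k
          = test_monomial 2 (1 - q ^ k) * ?p k" for k
        by (simp add: test_monomial_def power2_eq_square power_mult_distrib algebra_simps)
      moreover have "?s = x - q * x * (1 - x) / (1 + \<alpha>)"
        by (simp add: algebra_simps diff_divide_distrib)
      ultimately show "(\<lambda>k. test_monomial 2 (1 - q ^ k) * ?p k)
          sums (x - q * x * (1 - x) / (1 + \<alpha>))"
        by (simp only:)
    qed
    ultimately show ?thesis by simp
  qed
qed

end
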